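(* Let $(X,V,W,S,\mathcal H_*,h,*,\Theta)$ satisfy the abstract symmetrization framework described in the context. Assume that $f:X\to\mathbb R\cup\{+\infty\}$ is a proper, lower semi-continuous functional bounded from below such that $f(u^H)\le f(u)$ for all $u\in S$ and $H\in\mathcal H_*$. Moreover, assume that for all $u\in\mathrm{dom}(f)$ there exists $\xi\in S$ such that $f(\xi)\le f(u)$. Then for every $\rho>0$ and $\sigma>0$ there exists $v\in X$ with: (a) $\|v-v^*\|_V<(K(C_\Theta+1)+1)\rho$; (b) $f(w)\ge f(v)-\sigma\|w-v\|$ for all $w\in X$. In addition, one can assume that $f(v)\le f(u)$ and $\|v-u\|\le\rho+\|\mathbb T_\rho u-u\|$, where $u\in S$ is some element which satisfies $f(u)\le\inf f+\sigma\rho$.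
   Context: Abstract framework. $X,V,W$ are real Banach spaces with $X\subseteq V\subseteq W$, $X$ continuously embedded in $V$ and $V$ continuously embedded in $W$; $\|\cdot\|$ is the norm of $X$ and $K>0$ is a continuity constant of $X\hookrightarrow V$, i.e. $\|u\|_V\le K\|u\|$ for $u\in X$. $S\subseteq X$ carries the metric induced by $\|\cdot\|$, $\mathcal H_*$ is a path-connected topological space, and there are maps $*:S\to S$, $u\mapsto u^*$ (symmetrization) and $h:S\times\mathcal H_*\to S$, $(u,H)\mapsto u^H$ (polarization) such that: $h$ is continuous; $(u^* )^H=(u^H)^*=u^*$ and $(u^H)^H=u^H$ for all $u\in S$, $H\in\mathcal H_*$; there is a sequence $(H_m)\subset\mathcal H_*$ such that for every $u\in S$ the iterated polarizations $u^{H_1\cdots H_m}$ converge to $u^*$ in $V$ as $m\to\infty$; $\|u^H-v^H\|_V\le\|u-v\|_V$ for all $u,v\in S$, $H\in\mathcal H_*$. Moreover $\Theta:(X,\|\cdot\|_V)\to(S,\|\cdot\|_V)$ is Lipschitz with constant $C_\Theta>0$ and $\Theta|_S=\mathrm{Id}|_S$; for $u\in X$ one sets $u^H:=(\Theta(u))^H$ and $u^*:=(\Theta(u))^*$. For every $\rho>0$, $\mathbb T_\rho:S\to S$ denotes a continuous map such that, for every $u\in S$, $\mathbb T_\rho u$ is obtained from $u$ by finitely many iterated polarizations by elements of $\mathcal H_*$, and $\|\mathbb T_\rho u-u^*\|_V<\rho$ (such maps are known to exist in this framework). $\mathrm{dom}(f)=\{u\in X: f(u)<+\infty\}$; proper means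 $\mathrm{dom}(f)\neq\emptyset$. *)

theory Defs
  imports "HOL-Analysis.Analysis"
begin

text \<open>
  The chain \<open>X \<subseteq> V \<subseteq> W\<close> of Banach spaces is given by three types of class
  \<open>banach\<close>, each with its own norm, and injective bounded linear maps \<open>\<iota>\<close> and \<open>\<kappa>\<close>
  playing the role of the inclusions; so the \<open>V\<close>-norm of \<open>u \<in> X\<close> is \<open>norm (\<iota> u)\<close>.
\<close>

text \<open>
  \<open>iter_polarization h u [H\<^sub>1, \<dots>, H\<^sub>m]\<close> is \<open>u\<close> polarized first by \<open>H\<^sub>1\<close>, then by \<open>H\<^sub>2\<close>, and so on.
\<close>
definition iter_polarization :: "('x \<Rightarrow> 'h \<Rightarrow> 'x) \<Rightarrow> 'x \<Rightarrow> 'h list \<Rightarrow> 'x" where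
  "iter_polarization h u Hs = foldl h u Hs"

locale symmetrization_framework =
  fixes \<iota> :: "'x::banach \<Rightarrow> 'v::banach"
    and \<kappa> :: "'v \<Rightarrow> 'w::banach"
    and S :: "'x set"
    and \<H> :: "'h topology"
    and h :: "'x \<Rightarrow> 'h \<Rightarrow> 'x"
    and star :: "'x \<Rightarrow> 'x"
    and \<Theta> :: "'x \<Rightarrow> 'x"
    and K C\<^sub>\<Theta> :: real
  assumes embed_XV: "bounded_linear \<iota>" "inj \<iota>"
    and embed_VW: "bounded_linear \<kappa>" "inj \<kappa>"
    and K_pos: "0 < K"
    and K_bound: "norm (\<iota> u) \<le> K * norm u"
    and path_connected: "path_connected_space \<H>"
    and star_closed: "u \<in> S \<Longrightarrow> star u \<in> S"
    and pol_closed: "u \<in> S \<Longrightarrow> H \<in> topspace \<H> \<Longrightarrow> h u H \<in> S"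
    and pol_continuous:
      "continuous_map (prod_topology (top_of_set S) \<H>) (top_of_set S) (\<lambda>(u, H). h u H)"
    and pol_star: "u \<in> S \<Longrightarrow> H \<in> topspace \<H> \<Longrightarrow> h (star u) H = star u"
    and star_pol: "u \<in> S \<Longrightarrow> H \<in> topspace \<H> \<Longrightarrow> star (h u H) = star u"
    and pol_pol: "u \<in> S \<Longrightarrow> H \<in> topspace \<H> \<Longrightarrow> h (h u H) H = h u H"
    and approx:
      "\<exists>Hs :: nat \<Rightarrow> 'h. range Hs \<subseteq> topspace \<H> \<and>
         (\<forall>u\<in>S. (\<lambda>m. \<iota> (iter_polarization h u (map Hs [0..<m]))) \<longlonglongrightarrow> \<iota> (star u))"
    and pol_nonexpansive:
      "u \<in> S \<Longrightarrow> v \<in> S \<Longrightarrow> H \<in> topspace \<H> \<Longrightarrow>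
         norm (\<iota> (h u H) - \<iota> (h v H)) \<le> norm (\<iota> u - \<iota> v)"
    and C\<Theta>_pos: "0 < C\<^sub>\<Theta>"
    and \<Theta>_closed: "\<Theta> u \<in> S"
    and \<Theta>_lipschitz: "norm (\<iota> (\<Theta> u) - \<iota> (\<Theta> v)) \<le> C\<^sub>\<Theta> * norm (\<iota> u - \<iota> v)"
    and \<Theta>_id: "u \<in> S \<Longrightarrow> \<Theta> u = u"

text \<open>The symmetrization extended from \<open>S\<close> to all of \<open>X\<close>.\<close>
definition ext_star :: "('x \<Rightarrow> 'x) \<Rightarrow> ('x \<Rightarrow> 'x) \<Rightarrow> 'x \<Rightarrow> 'x" where
  "ext_star star \<Theta> u = star (\<Theta> u)"

text \<open>
  The family \<open>\<T>\<^sub>\<rho>\<close>, \<open>\<rho> > 0\<close>; continuity is with respect to the norm of \<open>X\<close>, and the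
  polarizations used for \<open>\<T>\<^sub>\<rho> u\<close> may depend on \<open>u\<close>.
\<close>
definition approximating_maps ::
  "('x::real_normed_vector \<Rightarrow> 'v::real_normed_vector) \<Rightarrow> 'x set \<Rightarrow> 'h topology \<Rightarrow>
   ('x \<Rightarrow> 'h \<Rightarrow> 'x) \<Rightarrow> ('x \<Rightarrow> 'x) \<Rightarrow> (real \<Rightarrow> 'x \<Rightarrow> 'x) \<Rightarrow> bool" where
  "approximating_maps \<iota> S \<H> h star \<T> \<longleftrightarrow>
     (\<forall>\<rho>>0. \<T> \<rho> \<in> S \<rightarrow> S \<and> continuous_on S (\<T> \<rho>) \<and>
        (\<forall>u\<in>S. (\<exists>Hs. set Hs \<subseteq> topspace \<H> \<and> \<T> \<rho> u = iter_polarization h u Hs) \<and>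
               norm (\<iota> (\<T> \<rho> u) - \<iota> (star u)) < \<rho>))"

definition effective_domain :: "('x \<Rightarrow> ereal) \<Rightarrow> 'x set" where
  "effective_domain f = {u. f u < \<infinity>}"

definition proper_functional :: "('x \<Rightarrow> ereal) \<Rightarrow> bool" where
  "proper_functional f \<longleftrightarrow> effective_domain f \<noteq> {}"

definition lower_semicontinuous :: "('x::topological_space \<Rightarrow> ereal) \<Rightarrow> bool" where
  "lower_semicontinuous f \<longleftrightarrow> (\<forall>x. f x \<le> Liminf (at x) f)"

end

theory Submission
  imports Defs
begin

text \<open>
  Pick an almost-minimizer \<open>u \<in> S\<close> and apply Ekeland's variational principle at
  \<open>\<T>\<^sub>\<rho> u\<close>, which is still an almost-minimizer because polarization does not
  increase \<open>f\<close>. The resulting \<open>v\<close> is \<open>\<rho>\<close>-close to \<open>\<T>\<^sub>\<rho> u\<close>, which is \<open>\<rho>\<close>-close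
  to its own symmetrization in \<open>V\<close>; and \<open>star\<close> is nonexpansive for the \<open>V\<close>-norm, being
  a limit of nonexpansive iterated polarizations.
\<close>

section \<open>Ekeland's variational principle in a complete metric space, by nested slices\<close>

definition ekeland_slice :: "('a::metric_space \<Rightarrow> ereal) \<Rightarrow> real \<Rightarrow> 'a \<Rightarrow> 'a set" where
  "ekeland_slice f \<sigma> x = {y. f y + ereal (\<sigma> * dist x y) \<le> f x}"

lemma mem_ekeland_slice_self: "x \<in> ekeland_slice f \<sigma> x"
  by (simp add: ekeland_slice_def)

text \<open>Transitivity of the Ekeland order, where \<open>y\<close> lies below \<open>x\<close> if
  passing from \<open>x\<close> to \<open>y\<close> lowers \<open>f\<close> by at least \<sigma>
  times the distance. The costs add up by the triangle inequality.\<close>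

lemma ekeland_slice_subset:
  assumes "0 \<le> \<sigma>" "y \<in> ekeland_slice f \<sigma> x"
  shows "ekeland_slice f \<sigma> y \<subseteq> ekeland_slice f \<sigma> x"
proof
  fix z assume "z \<in> ekeland_slice f \<sigma> y"
  then have z: "f z + ereal (\<sigma> * dist y z) \<le> f y"
    by (simp add: ekeland_slice_def)
  have "\<sigma> * dist x z \<le> \<sigma> * dist y z + \<sigma> * dist x y"
    using mult_left_mono[OF dist_triangle[of x z y] assms(1)] by (simp add: algebra_simps)
  then have "f z + ereal (\<sigma> * dist x z) \<le> f z + (ereal (\<sigma> * dist y z) + ereal (\<sigma> * dist x y))"
    by (intro add_left_mono) simp
  also have "\<dots> = (f z + ereal (\<sigma> * dist y z)) + ereal (\<sigma> * dist x y)"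
    by (simp only: add.assoc)
  also have "\<dots> \<le> f y + ereal (\<sigma> * dist x y)"
    by (intro add_right_mono z)
  also have "\<dots> \<le> f x"
    using assms(2) by (simp add: ekeland_slice_def)
  finally show "z \<in> ekeland_slice f \<sigma> x"
    by (simp add: ekeland_slice_def)
qed

lemma ekeland_slice_le:
  assumes "0 \<le> \<sigma>" "y \<in> ekeland_slice f \<sigma> x"
  shows "f y \<le> f x"
proof -
  have "f y + 0 \<le> f y + ereal (\<sigma> * dist x y)"
    using assms(1) by (intro add_left_mono) simp
  with assms(2) show ?thesis
    by (auto simp: ekeland_slice_def)
qed

text \<open>The slice is a sublevel set of the lower semicontinuous function
  \<open>f y + ereal (\<sigma> * dist x y)\<close> of \<open>y\<close>. Finiteness of
  \<open>f x\<close> lets the distance term move to the real side.\<close>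

lemma closed_ekeland_slice:
  fixes f :: "'a::metric_space \<Rightarrow> ereal"
  assumes lsc: "lower_semicontinuous f" and fin: "f x = ereal a"
  shows "closed (ekeland_slice f \<sigma> x)"
proof -
  have "\<exists>U. open U \<and> y \<in> U \<and> U \<subseteq> - ekeland_slice f \<sigma> x"
    if "y \<notin> ekeland_slice f \<sigma> x" for y
  proof -
    have "ereal (a - \<sigma> * dist x y) < f y"
      using that fin by (cases "f y") (auto simp: ekeland_slice_def)
    \<comment> \<open>The real \<open>r\<close> separates two conditions that persist near
      \<open>y\<close>: \<open>f\<close> stays above \<open>r\<close> by semicontinuity, the
      continuous bound stays below it.\<close>
    then obtain r where r: "ereal (a - \<sigma> * dist x y) < ereal r" "ereal r < f y"
      using ereal_dense2 by blast
    have "ereal r < Liminf (at y) f"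
      using lsc r(2) unfolding lower_semicontinuous_def by (meson less_le_trans)
    then have "\<forall>\<^sub>F z in at y. ereal r < f z"
      by (rule less_LiminfD)
    \<comment> \<open>The punctured filter omits \<open>y\<close> itself; \<open>r < f y\<close>
      supplies that point.\<close>
    then have 1: "\<forall>\<^sub>F z in nhds y. ereal r < f z"
      using r(2) by (simp add: eventually_nhds_conv_at)
    have "((\<lambda>z. a - \<sigma> * dist x z) \<longlongrightarrow> a - \<sigma> * dist x y) (nhds y)"
      by (intro tendsto_intros filterlim_ident)
    then have "\<forall>\<^sub>F z in nhds y. a - \<sigma> * dist x z < r"
      using r(1) by (intro order_tendstoD(2)) auto
    with 1 have "\<forall>\<^sub>F z in nhds y. z \<notin> ekeland_slice f \<sigma> x"
    proof eventually_elim
      case (elim z)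
      then show ?case
        using fin by (cases "f z") (auto simp: ekeland_slice_def)
    qed
    then show ?thesis
      by (auto simp: eventually_nhds subset_iff)
  qed
  then show ?thesis
    by (subst closed_def, subst open_subopen) auto
qed

text \<open>Take \<open>y\<close> within \<open>\<sigma> * e\<close> of the infimum of
  \<open>f\<close> over the slice of \<open>x\<close>. The slice of \<open>y\<close> lies in that of
  \<open>x\<close>, so \<open>f\<close> can drop by less than \<open>\<sigma> * e\<close> from
  \<open>y\<close>, which bounds the distance travelled.\<close>

lemma ekeland_slice_shrink:
  fixes f :: "'a::metric_space \<Rightarrow> ereal"
  assumes bound: "\<And>u. ereal c \<le> f u" and fin: "f x < \<infinity>"
    and pos: "0 < \<sigma>" "0 < e"
  obtains y where "y \<in> ekeland_slice f \<sigma> x" "f y < \<infinity>"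
    "\<And>z. z \<in> ekeland_slice f \<sigma> y \<Longrightarrow> dist y z < e"
proof -
  define m where "m = (INF y\<in>ekeland_slice f \<sigma> x. f y)"
  have "ereal c \<le> m"
    unfolding m_def by (intro INF_greatest bound)
  moreover have "m \<le> f x"
    unfolding m_def by (intro INF_lower mem_ekeland_slice_self)
  ultimately obtain b where b: "m = ereal b"
    using fin by (cases m) auto
  have "m < ereal (b + \<sigma> * e)"
    using pos b by simp
  then obtain y where y: "y \<in> ekeland_slice f \<sigma> x" "f y < ereal (b + \<sigma> * e)"
    unfolding m_def by (auto simp: INF_less_iff)
  have "dist y z < e" if z: "z \<in> ekeland_slice f \<sigma> y" for z
  proof -
    have "z \<in> ekeland_slice f \<sigma> x"
      using ekeland_slice_subset[of \<sigma> y f x] y(1) z pos by auto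
    then have "ereal b \<le> f z"
      unfolding b[symmetric] m_def by (rule INF_lower)
    moreover have "f z + ereal (\<sigma> * dist y z) \<le> f y"
      using z by (simp add: ekeland_slice_def)
    ultimately have "\<sigma> * dist y z < \<sigma> * e"
      using y(2) by (cases "f z"; cases "f y") auto
    then show ?thesis
      using pos by simp
  qed
  moreover have "f y < \<infinity>"
    using y(2) by (cases "f y") auto
  ultimately show thesis
    using that y(1) by blast
qed

text \<open>Cantor's intersection theorem on nested closed slices of vanishing diameter: their only
  common point is minimal for the Ekeland order.\<close>

theorem ekeland_variational_principle:
  fixes f :: "'a::complete_space \<Rightarrow> ereal"
  assumes lsc: "lower_semicontinuous f" and bound: "\<And>u. ereal c \<le> f u"
    and fin: "f x\<^sub>0 < \<infinity>" and pos: "0 < \<sigma>"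
  obtains v where "f v + ereal (\<sigma> * dist x\<^sub>0 v) \<le> f x\<^sub>0"
    "\<And>w. w \<noteq> v \<Longrightarrow> f v - ereal (\<sigma> * dist v w) < f w"
proof -
  let ?A = "ekeland_slice f \<sigma>"
  let ?P = "\<lambda>n x. x \<in> ?A x\<^sub>0 \<and> f x < \<infinity> \<and> (\<forall>z\<in>?A x. dist x z < 1 / Suc n)"
  \<comment> \<open>Each centre lies in the previous slice. Finiteness of \<open>f\<close> is
    carried along since both shrinking and closedness need it.\<close>
  have "\<exists>X. \<forall>n. ?P n (X n) \<and> X (Suc n) \<in> ?A (X n)"
  proof (rule dependent_nat_choice)
    obtain x where "x \<in> ?A x\<^sub>0" "f x < \<infinity>" "\<And>z. z \<in> ?A x \<Longrightarrow> dist x z < 1 / Suc 0"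
      by (rule ekeland_slice_shrink[where f = f, OF bound fin pos, of "1 / Suc 0"]) auto
    then show "\<exists>x. ?P 0 x"
      by blast
  next
    fix x n
    assume x: "?P n x"
    obtain y where "y \<in> ?A x" "f y < \<infinity>" "\<And>z. z \<in> ?A y \<Longrightarrow> dist y z < 1 / Suc (Suc n)"
      by (rule ekeland_slice_shrink[where f = f and x = x and e = "1 / Suc (Suc n)", OF bound _ pos])
        (use x in auto)
    moreover have "?A x \<subseteq> ?A x\<^sub>0"
      using x pos by (intro ekeland_slice_subset) auto
    ultimately show "\<exists>y. ?P (Suc n) y \<and> y \<in> ?A x"
      by blast
  qed
  then obtain X where X: "\<And>n. ?P n (X n)" "\<And>n. X (Suc n) \<in> ?A (X n)"
    by blast
  have "\<exists>v. \<Inter>(range (\<lambda>n. ?A (X n))) = {v}"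
  proof (rule decreasing_closed_nest_sing)
    fix n
    show "closed (?A (X n))"
      using X(1)[of n] bound[of "X n"]
      by (cases "f (X n)") (auto intro: closed_ekeland_slice[OF lsc])
    show "?A (X n) \<noteq> {}"
      using mem_ekeland_slice_self by blast
  next
    fix m n :: nat
    assume "m \<le> n"
    then show "?A (X n) \<subseteq> ?A (X m)"
      by (rule lift_Suc_antimono_le[rotated]) (use X(2) pos in \<open>simp add: ekeland_slice_subset\<close>)
  next
    fix e :: real
    assume "0 < e"
    \<comment> \<open>Half of \<open>e\<close>, because the slice is controlled by distance to its
      centre \<open>X n\<close>, so two of its points are compared through that centre.\<close>
    then obtain n where n: "1 / Suc n < e / 2"
      using nat_approx_posE[of "e / 2"] by auto
    have "dist y z < e" if "y \<in> ?A (X n)" "z \<in> ?A (X n)" for y z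
    proof -
      have "dist (X n) y < e / 2" "dist (X n) z < e / 2"
        using X(1)[of n] n that by force+
      then show ?thesis
        by (metis dist_commute dist_triangle_half_l)
    qed
    then show "\<exists>n. \<forall>y\<in>?A (X n). \<forall>z\<in>?A (X n). dist y z < e"
      by blast
  qed
  then obtain v where v: "\<Inter>(range (\<lambda>n. ?A (X n))) = {v}"
    by blast
  then have v_mem: "v \<in> ?A (X n)" for n
    by blast
  \<comment> \<open>By transitivity the slice of \<open>v\<close> lies in every slice of the
    sequence, hence in their intersection.\<close>
  have sub: "?A v \<subseteq> {v}"
    unfolding v[symmetric] using ekeland_slice_subset[OF _ v_mem] pos by (auto 4 3)
  have x0: "v \<in> ?A x\<^sub>0"
    using ekeland_slice_subset[of \<sigma> "X 0" f x\<^sub>0] X(1)[of 0] v_mem[of 0] pos by auto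
  have "f v < \<infinity>"
    using ekeland_slice_le[OF _ x0] pos fin by auto
  then obtain a where a: "f v = ereal a"
    using bound[of v] by (cases "f v") auto
  have "f v - ereal (\<sigma> * dist v w) < f w" if "w \<noteq> v" for w
  proof -
    have "w \<notin> ?A v"
      using sub that by blast
    then show ?thesis
      using a by (cases "f w") (auto simp: ekeland_slice_def)
  qed
  with x0 show thesis
    by (intro that) (auto simp: ekeland_slice_def)
qed

section \<open>Estimates for iterated polarizations and the extended symmetrization\<close>

context symmetrization_framework
begin

lemma iter_polarization_closed:
  "u \<in> S \<Longrightarrow> set Hs \<subseteq> topspace \<H> \<Longrightarrow> iter_polarization h u Hs \<in> S"
  by (induction Hs arbitrary: u) (auto simp: iter_polarization_def pol_closed)

lemma star_iter_polarization:
  "u \<in> S \<Longrightarrow> set Hs \<subseteq> topspace \<H> \<Longrightarrow> star (iter_polarization h u Hs) = star u"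
  by (induction Hs arbitrary: u) (auto simp: iter_polarization_def pol_closed star_pol)

lemma iter_polarization_nonexpansive:
  "u \<in> S \<Longrightarrow> v \<in> S \<Longrightarrow> set Hs \<subseteq> topspace \<H> \<Longrightarrow>
    norm (\<iota> (iter_polarization h u Hs) - \<iota> (iter_polarization h v Hs)) \<le> norm (\<iota> u - \<iota> v)"
proof (induction Hs arbitrary: u v)
  case (Cons H Hs)
  then have "norm (\<iota> (iter_polarization h (h u H) Hs) - \<iota> (iter_polarization h (h v H) Hs))
      \<le> norm (\<iota> (h u H) - \<iota> (h v H))"
    by (intro Cons.IH) (auto simp: pol_closed)
  also have "\<dots> \<le> norm (\<iota> u - \<iota> v)"
    using Cons.prems by (intro pol_nonexpansive) auto
  finally show ?case
    by (simp add: iter_polarization_def)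
qed (simp add: iter_polarization_def)

text \<open>The framework gives one sequence of polarizers valid for all of \<open>S\<close>, so
  \<open>u\<close> and \<open>v\<close> are polarized by the same lists and the bound passes to the
  limit.\<close>

lemma star_nonexpansive:
  assumes "u \<in> S" "v \<in> S"
  shows "norm (\<iota> (star u) - \<iota> (star v)) \<le> norm (\<iota> u - \<iota> v)"
proof -
  obtain Hs where Hs: "range Hs \<subseteq> topspace \<H>"
    and lim: "\<And>u. u \<in> S \<Longrightarrow>
      (\<lambda>m. \<iota> (iter_polarization h u (map Hs [0..<m]))) \<longlonglongrightarrow> \<iota> (star u)"
    using approx by blast
  have "(\<lambda>m. norm (\<iota> (iter_polarization h u (map Hs [0..<m]))
      - \<iota> (iter_polarization h v (map Hs [0..<m])))) \<longlonglongrightarrow> norm (\<iota> (star u) - \<iota> (star v))"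
    by (intro tendsto_norm tendsto_diff lim assms)
  then show ?thesis
    by (rule LIMSEQ_le_const2) (use Hs assms in \<open>auto intro!: exI[of _ 0] iter_polarization_nonexpansive dest: range_subsetD\<close>)
qed

lemma iter_polarization_le:
  assumes "\<And>u H. u \<in> S \<Longrightarrow> H \<in> topspace \<H> \<Longrightarrow> f (h u H) \<le> (f u :: ereal)"
  shows "u \<in> S \<Longrightarrow> set Hs \<subseteq> topspace \<H> \<Longrightarrow> f (iter_polarization h u Hs) \<le> f u"
proof (induction Hs arbitrary: u)
  case (Cons H Hs)
  then have "f (iter_polarization h (h u H) Hs) \<le> f (h u H)"
    by (intro Cons.IH) (auto simp: pol_closed)
  also have "\<dots> \<le> f u"
    using Cons.prems by (intro assms) auto
  finally show ?case
    by (simp add: iter_polarization_def)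
qed (simp add: iter_polarization_def)

lemma ext_star_lipschitz:
  "norm (\<iota> (ext_star star \<Theta> u) - \<iota> (ext_star star \<Theta> v)) \<le> C\<^sub>\<Theta> * norm (\<iota> u - \<iota> v)"
  unfolding ext_star_def
  using star_nonexpansive[OF \<Theta>_closed \<Theta>_closed] \<Theta>_lipschitz by (meson order_trans)

lemma embedding_diff_le: "norm (\<iota> u - \<iota> v) \<le> K * norm (u - v)"
  using K_bound[of "u - v"] bounded_linear.linear[OF embed_XV(1)] by (simp add: linear_diff)

end

section \<open>The Ekeland point near a polarized almost-minimizer\<close>

theorem theorem2p8:
  fixes \<iota> :: "'x::banach \<Rightarrow> 'v::banach"
    and \<kappa> :: "'v \<Rightarrow> 'w::banach"
    and S :: "'x set"
    and \<H> :: "'h topology"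
    and h :: "'x \<Rightarrow> 'h \<Rightarrow> 'x"
    and star \<Theta> :: "'x \<Rightarrow> 'x"
    and K C\<^sub>\<Theta> :: real
    and \<T> :: "real \<Rightarrow> 'x \<Rightarrow> 'x"
    and f :: "'x \<Rightarrow> ereal"
    and \<rho> \<sigma> :: real
  assumes "symmetrization_framework \<iota> \<kappa> S \<H> h star \<Theta> K C\<^sub>\<Theta>"
    and "approximating_maps \<iota> S \<H> h star \<T>"
    and "\<And>u. f u \<noteq> -\<infinity>"
    and "proper_functional f"
    and "lower_semicontinuous f"
    and "\<exists>c::real. \<forall>u. ereal c \<le> f u"
    and "\<And>u H. u \<in> S \<Longrightarrow> H \<in> topspace \<H> \<Longrightarrow> f (h u H) \<le> f u"
    and "\<And>u. u \<in> effective_domain f \<Longrightarrow> \<exists>\<xi>\<in>S. f \<xi> \<le> f u"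
    and "\<rho> > 0" and "\<sigma> > 0"
  shows "\<exists>v. norm (\<iota> v - \<iota> (ext_star star \<Theta> v)) < (K * (C\<^sub>\<Theta> + 1) + 1) * \<rho> \<and>
             (\<forall>w. f w \<ge> f v - ereal (\<sigma> * norm (w - v))) \<and>
             (\<exists>u\<in>S. f u \<le> (INF x. f x) + ereal (\<sigma> * \<rho>) \<and>
                    f v \<le> f u \<and> norm (v - u) \<le> \<rho> + norm (\<T> \<rho> u - u))"
proof -
  interpret symmetrization_framework \<iota> \<kappa> S \<H> h star \<Theta> K C\<^sub>\<Theta>
    by (rule assms)
  note pos = \<open>\<rho> > 0\<close> \<open>\<sigma> > 0\<close>
  obtain c where c: "\<And>u. ereal c \<le> f u"
    using assms(6) by blast
  define i where "i = (INF x. f x)"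
  obtain z where z: "f z < \<infinity>"
    using assms(4) by (auto simp: proper_functional_def effective_domain_def)
  \<comment> \<open>The infimum is finite, so adding \<open>\<sigma> * \<rho>\<close> makes it
    strictly larger and an almost-minimizer exists.\<close>
  have "ereal c \<le> i" "i \<le> f z"
    unfolding i_def by (auto intro: INF_greatest INF_lower c)
  then obtain b where b: "i = ereal b"
    using z by (cases i) auto
  have "i < ereal (b + \<sigma> * \<rho>)"
    using pos b by simp
  then obtain y where y: "f y < ereal (b + \<sigma> * \<rho>)"
    unfolding i_def by (auto simp: INF_less_iff)
  then have "f y < \<infinity>"
    by (cases "f y") auto
  \<comment> \<open>The almost-minimizer \<open>y\<close> may lie outside \<open>S\<close>; the
    hypothesis on the domain replaces it by a point of \<open>S\<close> with no larger
    value.\<close>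
  then obtain u where u: "u \<in> S" "f u \<le> f y"
    using assms(8)[of y] by (auto simp: effective_domain_def)
  have fu: "f u \<le> ereal (b + \<sigma> * \<rho>)"
    using u(2) y by simp
  define t where "t = \<T> \<rho> u"
  obtain Hs where Hs: "set Hs \<subseteq> topspace \<H>" "t = iter_polarization h u Hs"
    and near: "norm (\<iota> t - \<iota> (star u)) < \<rho>"
    using assms(2) u(1) pos unfolding approximating_maps_def t_def by blast
  \<comment> \<open>Polarizing leaves the symmetrization unchanged, so \<open>near\<close> compares
    \<open>t\<close> with its own symmetrization.\<close>
  have t: "t \<in> S" "star t = star u"
    using Hs u(1) by (simp_all add: iter_polarization_closed star_iter_polarization)
  have ft: "f t \<le> f u"
    unfolding Hs(2) using u(1) Hs(1) by (intro iter_polarization_le[where f = f] assms(7))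
  then have "f t < \<infinity>"
    using fu by (cases "f t") auto
  then obtain v where v: "f v + ereal (\<sigma> * dist t v) \<le> f t"
    and min: "\<And>w. w \<noteq> v \<Longrightarrow> f v - ereal (\<sigma> * dist v w) < f w"
    using ekeland_variational_principle[where f = f, OF assms(5) c _ pos(2)] by metis
  \<comment> \<open>Both values lie between the infimum and the infimum plus
    \<open>\<sigma> * \<rho>\<close>, so the drop from \<open>t\<close> to \<open>v\<close> is at
    most \<open>\<sigma> * \<rho>\<close>; cancelling \<sigma> leaves the distance bound
    \<rho>.\<close>
  have "ereal b \<le> f v"
    unfolding b[symmetric] i_def by (rule INF_lower) simp
  moreover have "f t \<le> ereal (b + \<sigma> * \<rho>)"
    using ft fu by (rule order_trans)
  ultimately have "\<sigma> * dist t v \<le> \<sigma> * \<rho>"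
    using v by (cases "f v"; cases "f t") auto
  then have tv: "norm (v - t) \<le> \<rho>"
    using pos by (simp add: dist_norm norm_minus_commute)
  then have V: "norm (\<iota> v - \<iota> t) \<le> K * \<rho>"
    using embedding_diff_le[of v t] K_pos by (meson mult_left_mono less_imp_le order_trans)
  have "norm (\<iota> (star u) - \<iota> (ext_star star \<Theta> v)) \<le> C\<^sub>\<Theta> * norm (\<iota> t - \<iota> v)"
    using ext_star_lipschitz[of t v] t by (simp add: ext_star_def \<Theta>_id)
  also have "\<dots> \<le> C\<^sub>\<Theta> * (K * \<rho>)"
    using V C\<Theta>_pos by (intro mult_left_mono) (auto simp: norm_minus_commute)
  finally have "norm (\<iota> (star u) - \<iota> (ext_star star \<Theta> v)) \<le> C\<^sub>\<Theta> * (K * \<rho>)" .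
  \<comment> \<open>The three terms contribute \<open>K * \<rho>\<close>, \<rho> and
    \<open>C\<^sub>\<Theta> * (K * \<rho>)\<close>; strictness comes from the middle one.\<close>
  moreover have "norm (\<iota> v - \<iota> (ext_star star \<Theta> v)) \<le> norm (\<iota> v - \<iota> t)
      + (norm (\<iota> t - \<iota> (star u)) + norm (\<iota> (star u) - \<iota> (ext_star star \<Theta> v)))"
    using norm_triangle_ineq[of "\<iota> v - \<iota> t" "\<iota> t - \<iota> (ext_star star \<Theta> v)"]
      norm_triangle_ineq[of "\<iota> t - \<iota> (star u)" "\<iota> (star u) - \<iota> (ext_star star \<Theta> v)"] by simp
  ultimately have a: "norm (\<iota> v - \<iota> (ext_star star \<Theta> v)) < (K * (C\<^sub>\<Theta> + 1) + 1) * \<rho>"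
    using V near by (simp add: algebra_simps)
  \<comment> \<open>The Ekeland inequality covers \<open>w \<noteq> v\<close>; for
    \<open>w = v\<close> the penalty vanishes.\<close>
  have "f v - ereal (\<sigma> * norm (w - v)) \<le> f w" for w
    using min[of w] by (cases "w = v") (auto simp: dist_norm norm_minus_commute)
  moreover have "norm (v - u) \<le> \<rho> + norm (\<T> \<rho> u - u)"
    using norm_triangle_ineq[of "v - t" "t - u"] tv by (simp add: t_def)
  moreover have "f u \<le> (INF x. f x) + ereal (\<sigma> * \<rho>)"
    using fu by (simp add: b[unfolded i_def])
  moreover have "f v \<le> f t"
    by (rule ekeland_slice_le[of \<sigma>]) (use v pos in \<open>auto simp: ekeland_slice_def\<close>)
  ultimately show ?thesis
    using a u(1) ft by (meson order_trans)
qed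

end
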